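(* Let $\mathcal{A}$ be a (randomized) algorithm that solves the wake-up problem with high probability in $f(n,\mathcal{C})$ rounds in the radio network model with $\mathcal{C}\ge 1$ channels and no collision detection (that is, for every network size $n$, every number of channels $\mathcal{C}\ge1$ and every non-empty set of activated nodes, the problem is solved within $f(n,\mathcal{C})$ rounds with probability at least $1-\frac1n$). Then for every $\mathcal{C}\ge 1$, $f(n,\mathcal{C})\in\Omega\!\left(\frac{\log^2 n}{\mathcal{C}}+\log n\right)$.
   Context: Multichannel radio network model (single hop, no collision detection): there are $n$ nodes with unique ids from $[n]=\{1,\dots,n\}$, every two of which are neighbors, and $\mathcal{C}\ge1$ orthogonal channels. Executions proceed in synchronous rounds. In each round each node chooses a single channel and either transmits a message or receives on it. A node $u$ receives a message from $v$ on channel $c$ in a round if and only if $u$ receives on $c$, $v$ transmits on $c$, and no other neighbor of $u$ transmits on $c$ in that round; otherwise $u$ receives nothing, and nodes cannot distinguish silence from collision. Wake-up problem: all nodes are initially inactive; at the beginning of the execution an adversary activates an arbitrary non-empty subset of the nodes. Inactive nodes can only listen, all on the same known default channel (channel $1$); active nodes execute an arbitrary randomized algorithm and have no advance knowledge of the identities of the other active nodes. The problem is solved in the first round in which exactly one active node transmits on channel $1$. Asymptotics are in $n\to\infty$, with $\mathcal{C}$ quantified first as in the claim. *)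

theory Defs
  imports "HOL-Probability.Probability" "HOL-Probability.Product_PMF" "HOL-Library.Landau_Symbols"
begin

datatype 'm operation = Transmit 'm | Receive

text \<open>An action is a channel together with an operation on it; channels are numbered from 1.\<close>

type_synonym 'm action = "nat \<times> 'm operation"

definition default_channel :: nat where
  "default_channel = 1"

text \<open>
  The program of one node, with internal states of type \<open>'s\<close> and messages of type \<open>'m\<close>. In each
  round it draws, with fresh private randomness, an action and an intermediate state; afterwards
  it is handed the received message, or \<open>None\<close> if nothing was received. Silence and collision
  are both reported as \<open>None\<close>, so there is no collision detection.
\<close>

record ('s, 'm) program =
  start :: 's
  draw :: "'s \<Rightarrow> ('m action \<times> 's) pmf"
  update :: "'s \<Rightarrow> 'm option \<Rightarrow> 's"

text \<open>
  \<open>A n C u\<close> is the program run by an active node with id \<open>u\<close> in a network of \<open>n\<close> nodes with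
  \<open>C\<close> channels. In particular, nodes know \<open>n\<close>, \<open>C\<close> and their own id, but not the set of
  active nodes.
\<close>

type_synonym ('s, 'm) algorithm = "nat \<Rightarrow> nat \<Rightarrow> nat \<Rightarrow> ('s, 'm) program"

definition uses_available_channels :: "('s, 'm) algorithm \<Rightarrow> bool" where
  "uses_available_channels A \<longleftrightarrow>
     (\<forall>n C u s. 1 \<le> C \<longrightarrow> u \<in> {1..n} \<longrightarrow>
        (\<forall>c x s'. ((c, x), s') \<in> set_pmf (draw (A n C u) s) \<longrightarrow> c \<in> {1..C}))"

definition transmits_on :: "(nat \<Rightarrow> 'm action) \<Rightarrow> nat \<Rightarrow> nat \<Rightarrow> bool" where
  "transmits_on a v c \<longleftrightarrow> (\<exists>m. a v = (c, Transmit m))"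

definition received :: "nat \<Rightarrow> (nat \<Rightarrow> 'm action) \<Rightarrow> nat \<Rightarrow> 'm option" where
  "received n a u =
     (case a u of
        (c, Transmit m) \<Rightarrow> None
      | (c, Receive) \<Rightarrow>
          if \<exists>!v. v \<in> {1..n} - {u} \<and> transmits_on a v c
          then Some (THE m. \<exists>v \<in> {1..n} - {u}. a v = (c, Transmit m))
          else None)"

text \<open>
  Distribution, after \<open>t\<close> rounds, of the states of the nodes and of the list of action profiles
  of the rounds so far, where \<open>S\<close> is the set of activated nodes. The active nodes choose
  independently; the default value of \<open>Pi_pmf\<close> makes every inactive node listen on the default
  channel (the state components of inactive nodes play no role). An inactive node can receive
  a message only in a round that solves the wake-up problem, so it does not matter what it
  does afterwards.
\<close>

primrec execution ::
  "(nat \<Rightarrow> ('s, 'm) program) \<Rightarrow> nat \<Rightarrow> nat set \<Rightarrow> nat \<Rightarrow>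
     ((nat \<Rightarrow> 's) \<times> (nat \<Rightarrow> 'm action) list) pmf" where
  "execution P n S 0 = return_pmf (\<lambda>u. start (P u), [])"
| "execution P n S (Suc t) =
     bind_pmf (execution P n S t) (\<lambda>(\<sigma>, h).
       map_pmf
         (\<lambda>d. let a = (\<lambda>u. fst (d u)) in
            (\<lambda>u. if u \<in> S then update (P u) (snd (d u)) (received n a u) else \<sigma> u, h @ [a]))
         (Pi_pmf S ((default_channel, Receive), undefined) (\<lambda>u. draw (P u) (\<sigma> u))))"

definition solves_in_round :: "nat set \<Rightarrow> (nat \<Rightarrow> 'm action) \<Rightarrow> bool" where
  "solves_in_round S a \<longleftrightarrow> (\<exists>!u. u \<in> S \<and> transmits_on a u default_channel)"

definition wakeup_solved_prob :: "(nat \<Rightarrow> ('s, 'm) program) \<Rightarrow> nat \<Rightarrow> nat set \<Rightarrow> nat \<Rightarrow> real" where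
  "wakeup_solved_prob P n S T =
     measure_pmf.prob (execution P n S T) {(\<sigma>, h). \<exists>a \<in> set h. solves_in_round S a}"

definition solves_wakeup_whp :: "('s, 'm) algorithm \<Rightarrow> (nat \<Rightarrow> nat \<Rightarrow> nat) \<Rightarrow> bool" where
  "solves_wakeup_whp A f \<longleftrightarrow>
     (\<forall>n C S. 1 \<le> n \<longrightarrow> 1 \<le> C \<longrightarrow> S \<subseteq> {1..n} \<longrightarrow> S \<noteq> {} \<longrightarrow>
        wakeup_solved_prob (A n C) n S (f n C) \<ge> 1 - 1 / real n)"

end

theory Submission
  imports Defs "HOL-Real_Asymp.Real_Asymp"
begin

text \<open>
  As long as no channel ever carries exactly one transmission, nobody receives anything and the
  nodes run independently of each other and of the activated set \<open>S\<close>. Fixing all coin tosses of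
  such isolated runs leaves a family \<open>\<F>\<close> of at most \<open>N = C T + 1\<close> sets (the transmitters per round
  and channel, and the set of all nodes), and \<open>T\<close> rounds fail on every non-empty \<open>S\<close> meeting no
  member of \<open>\<F>\<close> in exactly one node. Let \<open>S\<close> have density \<open>2\<^sup>-\<^sup>k\<close> with \<open>k \<le> K\<close>, \<open>K\<close> about \<open>(log n) / 2\<close>.
  At some scale \<open>k\<close> the small sets (greedily closed under adding a set that exceeds their union \<open>U\<close> by
  at most \<open>2\<^sup>k\<close> nodes) are all avoided and, by Harris' inequality, all other sets are hit twice
  outside \<open>U\<close>, with total probability at least \<open>exp (- 16 N / K)\<close>. Averaging over the coin tosses
  gives \<open>exp (- 16 N / K) \<le> K / n\<close>, hence \<open>N\<close> is of order at least \<open>log\<^sup>2 n\<close>.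
\<close>

section \<open>Random subsets and Harris' inequality\<close>

text \<open>For \<open>0 \<le> p \<le> 1\<close> this is the expectation of \<open>g\<close> on a
  random subset containing each element of \<open>V\<close> independently with probability
  \<open>p\<close>. A finite sum keeps induction on \<open>V\<close> and the exchange with other
  averages elementary.\<close>

definition random_subset_avg :: "real \<Rightarrow> 'a set \<Rightarrow> ('a set \<Rightarrow> real) \<Rightarrow> real" where
  "random_subset_avg p V g = (\<Sum>S\<in>Pow V. p ^ card S * (1 - p) ^ card (V - S) * g S)"

lemma random_subset_avg_empty [simp]: "random_subset_avg p {} g = g {}"
  by (simp add: random_subset_avg_def)

lemma random_subset_avg_insert:
  assumes "finite V" "a \<notin> V"
  shows "random_subset_avg p (insert a V) g =
    (1 - p) * random_subset_avg p V g + p * random_subset_avg p V (\<lambda>S. g (insert a S))"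
proof -
  let ?w = "\<lambda>S. p ^ card S * (1 - p) ^ card (insert a V - S) * g S"
  have disj: "Pow V \<inter> insert a ` Pow V = {}"
    using assms by auto
  have inj: "inj_on (insert a) (Pow V)"
    using assms by (auto simp: inj_on_def)
  have "random_subset_avg p (insert a V) g = sum ?w (Pow V) + sum ?w (insert a ` Pow V)"
    unfolding random_subset_avg_def Pow_insert using assms disj
    by (intro sum.union_disjoint) auto
  also have "sum ?w (insert a ` Pow V) = (\<Sum>S\<in>Pow V. ?w (insert a S))"
    by (subst sum.reindex[OF inj]) simp
  also have "\<dots> = p * random_subset_avg p V (\<lambda>S. g (insert a S))"
    unfolding random_subset_avg_def sum_distrib_left
  proof (rule sum.cong)
    fix S assume S: "S \<in> Pow V"
    then have "insert a V - insert a S = V - S" "a \<notin> S" "finite S"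
      using assms finite_subset by auto
    then show "?w (insert a S) = p * (p ^ card S * (1 - p) ^ card (V - S) * g (insert a S))"
      by (simp add: mult_ac)
  qed simp
  also have "sum ?w (Pow V) = (1 - p) * random_subset_avg p V g"
    unfolding random_subset_avg_def sum_distrib_left
  proof (rule sum.cong)
    fix S assume S: "S \<in> Pow V"
    then have "insert a V - S = insert a (V - S)" "a \<notin> V - S" "finite (V - S)"
      using assms finite_subset by auto
    then show "?w S = (1 - p) * (p ^ card S * (1 - p) ^ card (V - S) * g S)"
      by (simp add: mult_ac)
  qed simp
  finally show ?thesis .
qed

lemma random_subset_avg_mono:
  assumes "0 \<le> p" "p \<le> 1" "\<And>S. S \<subseteq> V \<Longrightarrow> f S \<le> g S"
  shows "random_subset_avg p V f \<le> random_subset_avg p V g"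
  unfolding random_subset_avg_def using assms by (intro sum_mono mult_left_mono) auto

lemma random_subset_avg_const [simp]:
  assumes "finite V"
  shows "random_subset_avg p V (\<lambda>_. c) = c"
  using assms by (induction V) (auto simp: random_subset_avg_insert algebra_simps)

lemma random_subset_avg_nonneg:
  assumes "0 \<le> p" "p \<le> 1" "\<And>S. S \<subseteq> V \<Longrightarrow> 0 \<le> g S"
  shows "0 \<le> random_subset_avg p V g"
  unfolding random_subset_avg_def using assms by (intro sum_nonneg mult_nonneg_nonneg) auto

text \<open>Induction on \<open>V\<close>, conditioning on the new element \<open>a\<close>. By
  monotonicity \<open>?E f1 - ?E f\<close> and \<open>?E g1 - ?E g\<close> are both nonnegative, so
  the covariance caused by the choice of \<open>a\<close> is nonnegative too.\<close>

lemma harris_inequality: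
  assumes "finite V" "0 \<le> p" "p \<le> 1" "mono f" "mono g"
  shows "random_subset_avg p V f * random_subset_avg p V g
    \<le> random_subset_avg p V (\<lambda>S. f S * g S)"
  using assms(1,4,5)
proof (induction V arbitrary: f g)
  case empty
  then show ?case by simp
next
  case (insert a V)
  define f1 where "f1 = (\<lambda>S. f (insert a S))"
  define g1 where "g1 = (\<lambda>S. g (insert a S))"
  have m: "mono f1" "mono g1"
    unfolding f1_def g1_def using insert.prems
    by (auto intro!: monoI intro: monoD[of f] monoD[of g] insert_mono)
  let ?E = "random_subset_avg p V"
  have le: "?E f \<le> ?E f1" "?E g \<le> ?E g1"
    unfolding f1_def g1_def using insert.prems assms
    by (auto intro!: random_subset_avg_mono intro: monoD)
  have "0 \<le> p * (1 - p) * ((?E f1 - ?E f) * (?E g1 - ?E g))"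
    using le assms by (intro mult_nonneg_nonneg) auto
  then have "((1 - p) * ?E f + p * ?E f1) * ((1 - p) * ?E g + p * ?E g1)
      \<le> (1 - p) * (?E f * ?E g) + p * (?E f1 * ?E g1)"
    by (simp add: algebra_simps)
  also have "\<dots> \<le> (1 - p) * ?E (\<lambda>S. f S * g S) + p * ?E (\<lambda>S. f1 S * g1 S)"
    using insert.IH[OF insert.prems] insert.IH[OF m] assms
    by (intro add_mono mult_left_mono) auto
  finally show ?case
    using insert.hyps by (simp add: random_subset_avg_insert f1_def g1_def)
qed

lemma harris_inequality_prod:
  assumes "finite V" "0 \<le> p" "p \<le> 1" "finite I"
    and "\<And>i. i \<in> I \<Longrightarrow> mono (f i)" "\<And>i S. i \<in> I \<Longrightarrow> 0 \<le> f i S"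
  shows "(\<Prod>i\<in>I. random_subset_avg p V (f i)) \<le> random_subset_avg p V (\<lambda>S. \<Prod>i\<in>I. f i S)"
  using assms(4-6)
proof (induction I)
  case empty
  then show ?case using assms(1) by simp
next
  case (insert i I)
  have "mono (\<lambda>S. \<Prod>j\<in>I. f j S)"
    using insert.prems by (intro monoI prod_mono) (auto dest: monoD)
  then have "random_subset_avg p V (f i) * random_subset_avg p V (\<lambda>S. \<Prod>j\<in>I. f j S)
      \<le> random_subset_avg p V (\<lambda>S. f i S * (\<Prod>j\<in>I. f j S))"
    using insert.prems assms(1-3) by (intro harris_inequality) auto
  moreover have "random_subset_avg p V (f i) * (\<Prod>j\<in>I. random_subset_avg p V (f j))
      \<le> random_subset_avg p V (f i) * random_subset_avg p V (\<lambda>S. \<Prod>j\<in>I. f j S)"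
    using insert assms(1-3) by (intro mult_left_mono random_subset_avg_nonneg) auto
  ultimately show ?case
    using insert.hyps by simp
qed

section \<open>Probabilities of avoiding and of hitting a fixed set\<close>

lemma random_subset_avg_disjoint:
  assumes "finite V"
  shows "random_subset_avg p V (\<lambda>S. of_bool (S \<inter> B = {})) = (1 - p) ^ card (V \<inter> B)"
  using assms
proof (induction V)
  case (insert a V)
  then show ?case
    by (cases "a \<in> B")
      (auto simp: random_subset_avg_insert Int_insert_left algebra_simps)
qed simp

lemma random_subset_avg_hit:
  assumes "finite V" "B \<subseteq> V"
  shows "random_subset_avg p V (\<lambda>S. of_bool (S \<inter> B \<noteq> {})) = 1 - (1 - p) ^ card B"
proof -
  have "random_subset_avg p V (\<lambda>S. of_bool (S \<inter> B \<noteq> {}))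
      = random_subset_avg p V (\<lambda>_. 1) - random_subset_avg p V (\<lambda>S. of_bool (S \<inter> B = {}))"
    unfolding random_subset_avg_def sum_subtractf[symmetric]
    by (intro sum.cong) (auto simp: algebra_simps)
  then show ?thesis
    using assms by (simp add: random_subset_avg_disjoint Int_absorb1)
qed

text \<open>Separates the decreasing event of avoiding \<open>U\<close> from the increasing hitting
  events: what remains is an unconditioned random subset of \<open>V - U\<close>, to which Harris'
  inequality applies.\<close>

lemma random_subset_avg_avoid:
  assumes "finite V" "U \<subseteq> V"
  shows "random_subset_avg p V (\<lambda>S. of_bool (S \<inter> U = {}) * g S)
    = (1 - p) ^ card U * random_subset_avg p (V - U) g"
proof -
  have "random_subset_avg p V (\<lambda>S. of_bool (S \<inter> U = {}) * g S)
      = (\<Sum>S\<in>Pow (V - U). p ^ card S * (1 - p) ^ card (V - S) * g S)"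
    unfolding random_subset_avg_def using assms
    by (intro sum.mono_neutral_cong_right) auto
  also have "\<dots> = (1 - p) ^ card U * random_subset_avg p (V - U) g"
    unfolding random_subset_avg_def sum_distrib_left
  proof (rule sum.cong)
    fix S assume "S \<in> Pow (V - U)"
    then have eq: "V - S = U \<union> (V - U - S)" "U \<inter> (V - U - S) = {}"
      using assms by auto
    have "card (V - S) = card U + card (V - U - S)"
      using assms by (subst eq(1), intro card_Un_disjoint) (auto dest: finite_subset)
    then show "p ^ card S * (1 - p) ^ card (V - S) * g S
        = (1 - p) ^ card U * (p ^ card S * (1 - p) ^ card (V - U - S) * g S)"
      by (simp add: power_add)
  qed simp
  finally show ?thesis .
qed

text \<open>With \<open>y = p m\<close>, \<open>(1 - p)^m \<le> exp (- y) \<le> 1 / (1 + y)\<close>,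
  and \<open>y / (1 + y) = 1 / (1 + 1 / y) \<ge> exp (- 1 / y)\<close>. Hitting a set of
  \<open>m\<close> elements thus costs \<open>1 / (p m)\<close> in the exponent, the kind of ratio
  that \<open>exists_scale\<close> sums.\<close>

lemma one_minus_power_ge_exp:
  fixes p :: real
  assumes "0 < p" "p \<le> 1" "0 < m"
  shows "exp (- 1 / (p * real m)) \<le> 1 - (1 - p) ^ m"
proof -
  define y where "y = p * real m"
  have y: "0 < y" using assms by (simp add: y_def)
  have "(1 - p) ^ m \<le> exp (- p) ^ m"
    using assms exp_ge_add_one_self[of "- p"] by (intro power_mono) auto
  also have "\<dots> = 1 / exp y"
    by (simp add: y_def exp_of_nat2_mult[symmetric] exp_minus field_simps)
  also have "\<dots> \<le> 1 / (1 + y)"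
    using y exp_ge_add_one_self[of y] by (intro divide_left_mono) auto
  finally have 1: "y / (1 + y) \<le> 1 - (1 - p) ^ m"
    using y by (simp add: field_simps)
  have "exp (- 1 / y) = 1 / exp (1 / y)"
    by (simp add: exp_minus field_simps)
  also have "\<dots> \<le> 1 / (1 + 1 / y)"
    using y exp_ge_add_one_self[of "1 / y"] by (intro divide_left_mono mult_pos_pos add_pos_pos) auto
  also have "\<dots> = y / (1 + y)"
    using y by (simp add: field_simps)
  finally show ?thesis
    using 1 by (simp add: y_def)
qed

lemma one_minus_ge_exp:
  fixes p :: real
  assumes "0 \<le> p" "p \<le> 1 / 2"
  shows "exp (- 2 * p) \<le> 1 - p"
proof -
  have "exp (- 2 * p) = 1 / exp (2 * p)"
    by (simp add: exp_minus field_simps)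
  also have "\<dots> \<le> 1 / (1 + 2 * p)"
    using assms exp_ge_add_one_self[of "2 * p"] by (intro divide_left_mono) auto
  also have "\<dots> \<le> 1 - p"
  proof -
    have "0 \<le> p * (1 - 2 * p)" using assms by (intro mult_nonneg_nonneg) auto
    then show ?thesis using assms by (simp add: field_simps)
  qed
  finally show ?thesis .
qed

section \<open>Set families isolating no element of a sparse random set\<close>

text \<open>Among the families whose union has grown by at most \<theta> per added set, take one
  with the most members: a remaining set with at most \<theta> new elements could still be
  added.\<close>

lemma greedy_closure_step:
  assumes "finite \<F>" "A \<subseteq> \<F>"
  obtains B where "A \<subseteq> B" "B \<subseteq> \<F>"
    "card (\<Union>B) \<le> card (\<Union>A) + \<theta> * (card B - card A)"
    "\<And>F. F \<in> \<F> - B \<Longrightarrow> \<theta> < card (F - \<Union>B)"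
proof -
  define P where "P = (\<lambda>B. A \<subseteq> B \<and> B \<subseteq> \<F> \<and>
    card (\<Union>B) \<le> card (\<Union>A) + \<theta> * (card B - card A))"
  have "P A"
    using assms by (simp add: P_def)
  moreover have "\<forall>B. P B \<longrightarrow> card B < Suc (card \<F>)"
    using assms by (auto simp: P_def less_Suc_eq_le intro: card_mono)
  ultimately obtain B where B: "P B" "\<And>B'. P B' \<Longrightarrow> card B' \<le> card B"
    using ex_has_greatest_nat[of P A card "Suc (card \<F>)"] by auto
  have finB: "finite B"
    using B(1) assms(1) by (auto simp: P_def intro: finite_subset)
  have "\<theta> < card (F - \<Union>B)" if F: "F \<in> \<F> - B" for F
  proof (rule ccontr)
    assume "\<not> \<theta> < card (F - \<Union>B)"
    then have small: "card (F - \<Union>B) \<le> \<theta>" by simp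
    have "card (\<Union>(insert F B)) = card (\<Union>B \<union> (F - \<Union>B))"
      by (rule arg_cong[of _ _ card]) auto
    also have "\<dots> \<le> card (\<Union>B) + card (F - \<Union>B)"
      by (rule card_Un_le)
    also have "\<dots> \<le> card (\<Union>A) + \<theta> * (card B - card A) + \<theta>"
      using B(1) small by (simp add: P_def)
    also have "\<dots> = card (\<Union>A) + \<theta> * (card (insert F B) - card A)"
      using F finB B(1) card_mono[of B A] by (simp add: P_def Suc_diff_le)
    finally have "P (insert F B)"
      using B(1) F by (auto simp: P_def)
    then show False
      using B(2) F finB by fastforce
  qed
  then show thesis
    using that B(1) by (auto simp: P_def)
qed

text \<open>\<open>v\<close> halves in every step up to the increments of \<open>a\<close>. The
  extra \<open>v K\<close> on the left is the potential that absorbs the term \<open>v k\<close> of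
  the recursion.\<close>

lemma sum_doubling_le:
  fixes a :: "nat \<Rightarrow> nat" and v :: "nat \<Rightarrow> real"
  assumes "v 0 = 0" "\<And>k. 2 * v (Suc k) \<le> v k + 2 * (real (a (Suc k)) - real (a k))"
  shows "(\<Sum>k=1..K. v k) + v K \<le> 2 * real (a K) - 2 * real (a 0)"
proof (induction K)
  case 0
  then show ?case using assms(1) by simp
next
  case (Suc K)
  then show ?case using assms(2)[of K] by simp
qed

text \<open>
  At scale \<open>k\<close> the random set has density \<open>2\<^sup>-\<^sup>k\<close>; the union of \<open>A\<close> will be avoided and every other
  member of \<open>\<F>\<close> hit at least twice. The last inequality bounds minus the logarithm of the
  probability of this. The closures grow with \<open>k\<close>, so the ratios \<open>2\<^sup>k / |F - \<Union>A|\<close> of a fixed \<open>F\<close> at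
  least double until \<open>F\<close> is absorbed: they sum to at most 2, and averaging over \<open>k\<close> finds a scale.
\<close>

lemma exists_scale:
  fixes \<F> :: "'a set set"
  assumes fin: "finite \<F>" "\<And>F. F \<in> \<F> \<Longrightarrow> finite F" and K: "1 \<le> K"
  obtains k A where "1 \<le> k" "k \<le> K" "A \<subseteq> \<F>"
    "\<And>F. F \<in> \<F> - A \<Longrightarrow> 2 ^ k < card (F - \<Union>A)"
    "2 * (real (card (\<Union>A)) / 2 ^ k) + (\<Sum>F\<in>\<F> - A. 6 * (2 ^ k / real (card (F - \<Union>A))))
      \<le> 16 * real (card \<F>) / real K"
proof -
  \<comment> \<open>The chain of closures starts at \<open>k = 0\<close> with the empty family,
    which gives \<open>v 0 = 0\<close>; the size condition holds only at the usable scales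
    \<open>k \<ge> 1\<close>.\<close>
  define Q where "Q = (\<lambda>k A. A \<subseteq> \<F> \<and> (k = 0 \<longrightarrow> A = {}) \<and>
    (0 < k \<longrightarrow> (\<forall>F\<in>\<F> - A. 2 ^ k < card (F - \<Union>A))))"
  define R where "R = (\<lambda>(k::nat) A (B::'a set set). A \<subseteq> B \<and>
    card (\<Union>B) \<le> card (\<Union>A) + 2 ^ Suc k * (card B - card A))"
  have "\<exists>A. \<forall>k. Q k (A k) \<and> R k (A k) (A (Suc k))"
  proof (rule dependent_nat_choice)
    show "\<exists>A. Q 0 A" by (simp add: Q_def)
  next
    fix A k assume "Q k A"
    then have "A \<subseteq> \<F>" by (simp add: Q_def)
    then obtain B where "A \<subseteq> B" "B \<subseteq> \<F>"
      "card (\<Union>B) \<le> card (\<Union>A) + 2 ^ Suc k * (card B - card A)"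
      "\<And>F. F \<in> \<F> - B \<Longrightarrow> 2 ^ Suc k < card (F - \<Union>B)"
      using greedy_closure_step[OF fin(1), where \<theta> = "2 ^ Suc k"] by metis
    then show "\<exists>B. Q (Suc k) B \<and> R k A B"
      by (auto simp: Q_def R_def)
  qed
  then obtain A where Q: "\<And>k. Q k (A k)" and R: "\<And>k. R k (A k) (A (Suc k))"
    by blast
  have sub: "A k \<subseteq> \<F>" for k
    using Q by (simp add: Q_def)
  have finA: "finite (A k)" for k
    using sub fin(1) finite_subset by blast
  have finU: "finite (\<Union>(A k))" for k
    using finA sub fin(2) by blast
  have step: "A k \<subseteq> A (Suc k)" for k
    using R by (simp add: R_def)
  have A0: "A 0 = {}"
    using Q[of 0] by (simp add: Q_def)
  have big: "2 ^ k < card (F - \<Union>(A k))" if "F \<in> \<F> - A k" "0 < k" for k F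
    using Q[of k] that by (simp add: Q_def)
  define v where "v = (\<lambda>k. real (card (\<Union>(A k))) / 2 ^ k)"
  define r where "r = (\<lambda>k F. 2 ^ k / real (card (F - \<Union>(A k))))"

  have "(\<Sum>k=1..K. v k) + v K \<le> 2 * real (card (A K)) - 2 * real (card (A 0))"
  proof (rule sum_doubling_le)
    show "v 0 = 0" by (simp add: v_def A0)
    fix k
    have le: "card (A k) \<le> card (A (Suc k))"
      using step finA by (intro card_mono) auto
    have "card (\<Union>(A (Suc k))) \<le> card (\<Union>(A k)) + 2 ^ Suc k * (card (A (Suc k)) - card (A k))"
      using R by (simp add: R_def)
    then have "real (card (\<Union>(A (Suc k))))
        \<le> real (card (\<Union>(A k)) + 2 ^ Suc k * (card (A (Suc k)) - card (A k)))"
      by (rule of_nat_mono)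
    then have "real (card (\<Union>(A (Suc k)))) \<le> real (card (\<Union>(A k)))
        + 2 ^ Suc k * (real (card (A (Suc k))) - real (card (A k)))"
      using le by (simp add: of_nat_diff)
    then show "2 * v (Suc k) \<le> v k + 2 * (real (card (A (Suc k))) - real (card (A k)))"
      by (simp add: v_def field_simps)
  qed
  moreover have "0 \<le> v K" "card (A K) \<le> card \<F>"
    using sub fin by (auto simp: v_def intro: card_mono)
  ultimately have sum_v: "(\<Sum>k=1..K. v k) \<le> 2 * real (card \<F>)"
    by simp

  have sum_r: "(\<Sum>k\<in>{k\<in>{1..K}. F \<notin> A k}. r k F) \<le> 2" if F: "F \<in> \<F>" for F
  proof -
    \<comment> \<open>The second conjunct carries the induction: while \<open>F\<close> is not
      absorbed the ratios at least double, so their sum is at most twice the last one, which is at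
      most 1.\<close>
    have "(\<Sum>k\<in>{k\<in>{1..K}. F \<notin> A k}. r k F) \<le> 2 \<and>
        (F \<notin> A K \<longrightarrow> (\<Sum>k\<in>{k\<in>{1..K}. F \<notin> A k}. r k F) \<le> 2 * r K F)"
    proof (induction K)
      case 0
      then show ?case by (simp add: r_def)
    next
      case (Suc K)
      show ?case
      proof (cases "F \<in> A (Suc K)")
        case True
        then have "{k \<in> {1..Suc K}. F \<notin> A k} = {k \<in> {1..K}. F \<notin> A k}"
          by (auto simp: le_Suc_eq)
        then show ?thesis using Suc True by simp
      next
        case False
        then have notin: "F \<notin> A K" using step by blast
        have eq: "{k \<in> {1..Suc K}. F \<notin> A k} = insert (Suc K) {k \<in> {1..K}. F \<notin> A k}"
          using False by (auto simp: le_Suc_eq)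
        have sum: "(\<Sum>k\<in>{k\<in>{1..Suc K}. F \<notin> A k}. r k F)
            = r (Suc K) F + (\<Sum>k\<in>{k\<in>{1..K}. F \<notin> A k}. r k F)"
          unfolding eq by (subst sum.insert) auto
        have large: "2 ^ Suc K < card (F - \<Union>(A (Suc K)))"
          using big[of F "Suc K"] F False by simp
        have le: "card (F - \<Union>(A (Suc K))) \<le> card (F - \<Union>(A K))"
          using step fin(2)[OF F] by (intro card_mono) auto
        have pos: "0 < card (F - \<Union>(A (Suc K)))"
          using large by (meson le_less_trans zero_le)
        have "2 * r K F \<le> r (Suc K) F"
          unfolding r_def using le pos by (simp add: divide_left_mono)
        moreover have "real (2 ^ Suc K) \<le> real (card (F - \<Union>(A (Suc K))))"
          using large by (intro of_nat_mono less_imp_le)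
        then have "r (Suc K) F \<le> 1"
          unfolding r_def using pos by (simp add: divide_le_eq)
        ultimately show ?thesis
          using Suc notin sum by auto
      qed
    qed
    then show ?thesis by blast
  qed
  \<comment> \<open>Avoiding costs \<open>2 p\<close> per node and hitting \<open>F\<close> twice
    costs 6 times its ratio; summed over all scales this is \<open>2 * 2 + 6 * 2 = 16\<close> per
    member of \<open>\<F>\<close>.\<close>
  define cost where "cost = (\<lambda>k. 2 * v k + (\<Sum>F\<in>\<F> - A k. 6 * r k F))"
  have "(\<Sum>k=1..K. \<Sum>F\<in>\<F> - A k. r k F) = (\<Sum>k=1..K. \<Sum>F\<in>\<F>. if F \<notin> A k then r k F else 0)"
    using fin by (intro sum.cong refl sum.mono_neutral_cong_left) auto
  also have "\<dots> = (\<Sum>F\<in>\<F>. \<Sum>k=1..K. if F \<notin> A k then r k F else 0)"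
    by (rule sum.swap)
  also have "\<dots> = (\<Sum>F\<in>\<F>. \<Sum>k\<in>{k\<in>{1..K}. F \<notin> A k}. r k F)"
    by (intro sum.cong refl sum.mono_neutral_cong_right) auto
  also have "\<dots> \<le> (\<Sum>F\<in>\<F>. 2)"
    by (intro sum_mono sum_r)
  finally have "(\<Sum>k=1..K. \<Sum>F\<in>\<F> - A k. r k F) \<le> 2 * real (card \<F>)"
    by simp
  then have total: "(\<Sum>k=1..K. cost k) \<le> 16 * real (card \<F>)"
    using sum_v by (simp add: cost_def sum.distrib flip: sum_distrib_left)
  have "\<exists>k\<in>{1..K}. cost k \<le> 16 * real (card \<F>) / real K"
  proof (rule ccontr)
    assume "\<not> ?thesis"
    then have "(\<Sum>k=1..K. 16 * real (card \<F>) / real K) < (\<Sum>k=1..K. cost k)"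
      using K by (intro sum_strict_mono) (auto simp: not_le)
    then show False
      using total K by simp
  qed
  then obtain k where "1 \<le> k" "k \<le> K" "cost k \<le> 16 * real (card \<F>) / real K"
    by auto
  then show thesis
    using that[of k "A k"] sub big by (auto simp: cost_def v_def r_def)
qed

definition isolates_none :: "'a set set \<Rightarrow> 'a set \<Rightarrow> bool" where
  "isolates_none \<F> S \<longleftrightarrow> (\<forall>F\<in>\<F>. card (F \<inter> S) \<noteq> 1)"

lemma random_subset_isolates_none:
  assumes fin: "finite V" "\<F> \<subseteq> Pow V" "V \<in> \<F>" and K: "1 \<le> K"
    and N: "card \<F> \<le> N" and large: "2 ^ K * (8 * real N) < real K * real (card V)"
  shows "\<exists>k\<in>{1..K}. exp (- (16 * real N / real K))
    \<le> random_subset_avg (1 / 2 ^ k) V (\<lambda>S. of_bool (S \<noteq> {} \<and> isolates_none \<F> S))"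
proof -
  have finF: "finite \<F>" "\<And>F. F \<in> \<F> \<Longrightarrow> finite F"
    using fin by (auto dest: finite_subset)
  obtain k A where k: "1 \<le> k" "k \<le> K" and A: "A \<subseteq> \<F>"
    and big: "\<And>F. F \<in> \<F> - A \<Longrightarrow> 2 ^ k < card (F - \<Union>A)"
    and cost: "2 * (real (card (\<Union>A)) / 2 ^ k)
      + (\<Sum>F\<in>\<F> - A. 6 * (2 ^ k / real (card (F - \<Union>A)))) \<le> 16 * real (card \<F>) / real K"
    using exists_scale[OF finF K] by metis
  define U where "U = \<Union>A"
  define p :: real where "p = 1 / 2 ^ k"
  have p: "0 < p" "p \<le> 1 / 2" "p \<le> 1"
    using k power_increasing[of 1 k "2::real"] by (auto simp: p_def field_simps)
  have U: "U \<subseteq> V" using A fin by (auto simp: U_def)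
  have costN: "2 * (p * real (card U)) + (\<Sum>F\<in>\<F> - A. 6 / (p * real (card (F - U))))
      \<le> 16 * real N / real K"
  proof -
    have "16 * real (card \<F>) / real K \<le> 16 * real N / real K"
      using N by (intro divide_right_mono) auto
    then show ?thesis
      using cost by (simp add: U_def p_def)
  qed
  \<comment> \<open>Avoiding all of \<open>V\<close> alone would exceed the cost bound, by
    \<open>large\<close>. Hence \<open>V\<close> is among the sets to be hit, which makes
    \<open>S\<close> non-empty.\<close>
  have "V \<notin> A"
  proof
    assume "V \<in> A"
    then have "U = V" using U by (auto simp: U_def)
    moreover have "0 \<le> (\<Sum>F\<in>\<F> - A. 6 / (p * real (card (F - U))))"
      using p by (intro sum_nonneg) auto
    ultimately have "2 * (p * real (card V)) \<le> 16 * real N / real K"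
      using costN by simp
    then have "real K * real (card V) \<le> 2 ^ k * (8 * real N)"
      using K by (simp add: p_def field_simps)
    also have "\<dots> \<le> 2 ^ K * (8 * real N)"
      using k by (intro mult_right_mono power_increasing) auto
    finally show False using large by simp
  qed
  have "\<exists>H. H \<subseteq> F - U \<and> card H = card (F - U) div 2" for F
    using obtain_subset_with_card_n[of "card (F - U) div 2" "F - U"]
    by (metis div_le_dividend)
  then obtain H where H: "\<And>F. H F \<subseteq> F - U" "\<And>F. card (H F) = card (F - U) div 2"
    by metis
  define H' where "H' = (\<lambda>F. (F - U) - H F)"
  \<comment> \<open>Being met by \<open>S\<close> in both halves of \<open>F - U\<close> is a product of two increasing events
    and forces two elements of \<open>F\<close>.\<close>
  define hit :: "'a set \<Rightarrow> 'a set \<Rightarrow> real" where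
    "hit = (\<lambda>F S. of_bool (S \<inter> H F \<noteq> {}) * of_bool (S \<inter> H' F \<noteq> {}))"
  have hit_avg: "exp (- (6 / (p * real (card (F - U))))) \<le> random_subset_avg p (V - U) (hit F)"
    if F: "F \<in> \<F> - A" for F
  proof -
    have FV: "F \<subseteq> V" "finite F" using F fin finF by auto
    define m where "m = card (F - U)"
    have "(1::nat) \<le> 2 ^ k" by simp
    then have m: "2 \<le> m"
      using big[OF F] unfolding m_def U_def by linarith
    have finH: "finite (H F)" using H(1)[of F] FV finite_subset by blast
    have cH': "card (H' F) = m - m div 2"
      unfolding H'_def m_def using H(1)[of F] H(2)[of F] finH by (simp add: card_Diff_subset)
    \<comment> \<open>For \<open>m \<ge> 2\<close> integer halving leaves at least a third of the
      elements on each side (\<open>m = 3\<close> is the worst case); two hits at cost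
      \<open>3 / (p m)\<close> each give the constant 6.\<close>
    have half: "exp (- (3 / (p * real m))) \<le> random_subset_avg p (V - U) (\<lambda>S. of_bool (S \<inter> B \<noteq> {}))"
      if B: "B \<subseteq> V - U" "m \<le> 3 * card B" for B
    proof -
      have "0 < card B" "real m \<le> 3 * real (card B)" using B m by linarith+
      then have "1 / (p * real (card B)) \<le> 3 / (p * real m)"
        using p m by (simp add: field_simps)
      then have "exp (- (3 / (p * real m))) \<le> exp (- 1 / (p * real (card B)))"
        by simp
      also have "\<dots> \<le> 1 - (1 - p) ^ card B"
        using p \<open>0 < card B\<close> by (intro one_minus_power_ge_exp) auto
      finally show ?thesis
        using random_subset_avg_hit[of "V - U" B p] B fin by simp
    qed
    have "exp (- (6 / (p * real m))) = exp (- (3 / (p * real m))) * exp (- (3 / (p * real m)))"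
      by (simp flip: exp_add)
    also have "\<dots> \<le> random_subset_avg p (V - U) (\<lambda>S. of_bool (S \<inter> H F \<noteq> {}))
        * random_subset_avg p (V - U) (\<lambda>S. of_bool (S \<inter> H' F \<noteq> {}))"
    proof (intro mult_mono half)
      show "m \<le> 3 * card (H F)" using H(2)[of F] m by (simp add: m_def[symmetric])
      show "m \<le> 3 * card (H' F)" using cH' m by linarith
      show "0 \<le> random_subset_avg p (V - U) (\<lambda>S. of_bool (S \<inter> H F \<noteq> {}))"
        using p by (intro random_subset_avg_nonneg) auto
    qed (use H(1)[of F] FV in \<open>auto simp: H'_def\<close>)
    also have "\<dots> \<le> random_subset_avg p (V - U) (hit F)"
      unfolding hit_def using p fin by (intro harris_inequality) (fastforce intro!: monoI)+
    finally show ?thesis by (simp add: m_def)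
  qed
  have "exp (- (16 * real N / real K))
      \<le> exp (- (2 * (p * real (card U))) + (\<Sum>F\<in>\<F> - A. - (6 / (p * real (card (F - U))))))"
    using costN by (simp add: sum_negf)
  also have "\<dots> = exp (- 2 * p) ^ card U * (\<Prod>F\<in>\<F> - A. exp (- (6 / (p * real (card (F - U))))))"
    using finF by (simp only: exp_add) (simp add: exp_sum exp_of_nat2_mult[symmetric])
  also have "\<dots> \<le> (1 - p) ^ card U * (\<Prod>F\<in>\<F> - A. random_subset_avg p (V - U) (hit F))"
    using p hit_avg one_minus_ge_exp[of p]
    by (intro mult_mono power_mono prod_mono) (auto intro!: prod_nonneg)
  also have "\<dots> \<le> (1 - p) ^ card U * random_subset_avg p (V - U) (\<lambda>S. \<Prod>F\<in>\<F> - A. hit F S)"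
  proof (intro mult_left_mono harris_inequality_prod)
    fix F show "mono (hit F)"
      unfolding hit_def by (intro monoI mult_mono) auto
  qed (use p fin finF in \<open>auto simp: hit_def\<close>)
  also have "\<dots> = random_subset_avg p V (\<lambda>S. of_bool (S \<inter> U = {}) * (\<Prod>F\<in>\<F> - A. hit F S))"
    using fin U by (simp add: random_subset_avg_avoid)
  also have "\<dots> \<le> random_subset_avg p V (\<lambda>S. of_bool (S \<noteq> {} \<and> isolates_none \<F> S))"
  proof (rule random_subset_avg_mono)
    fix S assume S: "S \<subseteq> V"
    show "of_bool (S \<inter> U = {}) * (\<Prod>F\<in>\<F> - A. hit F S)
        \<le> (of_bool (S \<noteq> {} \<and> isolates_none \<F> S) :: real)"
    proof (cases "S \<inter> U = {} \<and> (\<forall>F\<in>\<F> - A. S \<inter> H F \<noteq> {} \<and> S \<inter> H' F \<noteq> {})")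
      case True
      have "card (F \<inter> S) \<noteq> 1" if F: "F \<in> \<F>" for F
      proof (cases "F \<in> A")
        case True
        then have "F \<inter> S = {}"
          using \<open>S \<inter> U = {} \<and> _\<close> by (auto simp: U_def)
        then show ?thesis by simp
      next
        case False
        then obtain x y where "x \<in> S \<inter> H F" "y \<in> S \<inter> H' F"
          using True F by blast
        then have "x \<in> F \<inter> S" "y \<in> F \<inter> S" "x \<noteq> y"
          using H(1)[of F] by (auto simp: H'_def)
        then show ?thesis by (metis card_1_singletonE singletonD)
      qed
      moreover have "S \<noteq> {}"
        using True \<open>V \<notin> A\<close> fin by blast
      ultimately have "S \<noteq> {} \<and> isolates_none \<F> S"
        by (simp add: isolates_none_def)
      moreover have "(\<Prod>F\<in>\<F> - A. hit F S) \<le> 1"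
        by (intro prod_le_1) (auto simp: hit_def)
      ultimately show ?thesis by simp
    next
      case False
      then have eq: "of_bool (S \<inter> U = {}) * (\<Prod>F\<in>\<F> - A. hit F S) = 0"
        using finF by (auto simp: hit_def)
      show ?thesis unfolding eq by simp
    qed
  qed (use p in auto)
  finally show ?thesis
    using k unfolding p_def by auto
qed

section \<open>Executions without receptions\<close>

text \<open>All channels count, not only the default one: a lone transmission on any channel could
  pass information to a listener.\<close>

definition quiet_round :: "nat set \<Rightarrow> (nat \<Rightarrow> 'm action) \<Rightarrow> bool" where
  "quiet_round S a \<longleftrightarrow> (\<forall>c. \<not> (\<exists>!u. u \<in> S \<and> transmits_on a u c))"

definition quiet_history :: "nat set \<Rightarrow> (nat \<Rightarrow> 'm action) list \<Rightarrow> bool" where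
  "quiet_history S h \<longleftrightarrow> (\<forall>a\<in>set h. quiet_round S a)"

text \<open>A listener does not transmit itself and inactive nodes only listen, so the transmitters
  it can hear on its channel are exactly those in \<open>S\<close>.\<close>

lemma received_quiet_round:
  assumes "quiet_round S a" "S \<subseteq> {1..n}" "\<And>v. v \<notin> S \<Longrightarrow> a v = (default_channel, Receive)"
  shows "received n a u = None"
proof -
  have "received n a u = None" if au: "a u = (c, Receive)" for c
  proof -
    have "\<not> (\<exists>!v. v \<in> {1..n} - {u} \<and> transmits_on a v c)"
    proof -
      have "(v \<in> {1..n} - {u} \<and> transmits_on a v c) \<longleftrightarrow> (v \<in> S \<and> transmits_on a v c)" for v
        using assms(2) assms(3)[of v] au by (cases "v \<in> S") (auto simp: transmits_on_def)
      then show ?thesis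
        using assms(1) by (simp add: quiet_round_def)
    qed
    then show ?thesis
      unfolding received_def using au by simp
  qed
  then show ?thesis
    by (cases "a u"; cases "snd (a u)") (auto simp: received_def)
qed

section \<open>Comparison with executions in which every reception is suppressed\<close>

primrec silent_execution ::
  "(nat \<Rightarrow> ('s, 'm) program) \<Rightarrow> nat set \<Rightarrow> nat \<Rightarrow>
     ((nat \<Rightarrow> 's) \<times> (nat \<Rightarrow> 'm action) list) pmf" where
  "silent_execution P S 0 = return_pmf (\<lambda>u. start (P u), [])"
| "silent_execution P S (Suc t) =
     bind_pmf (silent_execution P S t) (\<lambda>(\<sigma>, h).
       map_pmf
         (\<lambda>d. (\<lambda>u. if u \<in> S then update (P u) (snd (d u)) None else \<sigma> u, h @ [\<lambda>u. fst (d u)]))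
         (Pi_pmf S ((default_channel, Receive), undefined) (\<lambda>u. draw (P u) (\<sigma> u))))"

text \<open>Intermediate outcomes outside \<open>X\<close> cannot lead to \<open>y\<close>, so
  agreement on \<open>X\<close> suffices.\<close>

lemma pmf_bind_cong_on:
  assumes "\<And>x. x \<in> X \<Longrightarrow> pmf M x = pmf M' x"
    and "\<And>x. x \<in> X \<Longrightarrow> pmf (K x) y = pmf (K' x) y"
    and "\<And>x. x \<notin> X \<Longrightarrow> pmf (K x) y = 0 \<and> pmf (K' x) y = 0"
  shows "pmf (bind_pmf M K) y = pmf (bind_pmf M' K') y"
proof -
  have "ennreal (pmf (bind_pmf M K) y) = ennreal (pmf (bind_pmf M' K') y)"
    unfolding ennreal_pmf_bind nn_integral_measure_pmf
  proof (rule nn_integral_cong)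
    fix x
    show "ennreal (pmf M x) * ennreal (pmf (K x) y) = ennreal (pmf M' x) * ennreal (pmf (K' x) y)"
      using assms[of x] by (cases "x \<in> X") auto
  qed
  then show ?thesis by simp
qed

lemma pmf_map_cong_on:
  assumes "\<And>d. d \<in> set_pmf D \<Longrightarrow> f d = y \<longleftrightarrow> g d = y"
  shows "pmf (map_pmf f D) y = pmf (map_pmf g D) y"
  unfolding pmf_map using assms by (intro measure_pmf.finite_measure_eq_AE) (auto simp: AE_measure_pmf_iff)

lemma pmf_map_eq_0:
  assumes "\<And>d. f d \<noteq> y"
  shows "pmf (map_pmf f D) y = 0"
  using assms by (auto simp: pmf_eq_0_set_pmf)

text \<open>Histories only grow, so a quiet one has quiet prefixes, and in a quiet round both update
  rules see \<open>None\<close>. The claim is pointwise because the distributions may differ on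
  other histories.\<close>

lemma pmf_execution_quiet:
  assumes "S \<subseteq> {1..n}" "quiet_history S (snd y)"
  shows "pmf (execution P n S t) y = pmf (silent_execution P S t) y"
  using assms(2)
proof (induction t arbitrary: y)
  case 0
  then show ?case by simp
next
  case (Suc t)
  have fin: "finite S" using assms(1) finite_subset by blast
  show ?case
    unfolding execution.simps silent_execution.simps
  proof (rule pmf_bind_cong_on[where X = "{x. quiet_history S (snd x)}"], goal_cases)
    case (1 x)
    then show ?case using Suc.IH by simp
  next
    case (2 x)
    obtain \<sigma> h where x: "x = (\<sigma>, h)" by (cases x)
    show ?case
      unfolding x prod.case Let_def
    proof (rule pmf_map_cong_on, goal_cases)
      case (1 d)
      have "d u = ((default_channel, Receive), undefined)" if "u \<notin> S" for u
        using 1 set_Pi_pmf_subset[OF fin] that by fastforce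
      then have "received n (\<lambda>u. fst (d u)) u = None" if "snd y = h @ [\<lambda>u. fst (d u)]" for u
        using Suc.prems assms(1) that
        by (intro received_quiet_round[of S]) (auto simp: quiet_history_def)
      then show ?case
        by (cases y) (auto simp: fun_eq_iff)
    qed
  next
    case (3 x)
    obtain \<sigma> h where x: "x = (\<sigma>, h)" by (cases x)
    have "(\<sigma>', h @ [a]) \<noteq> y" for \<sigma>' a
      using 3 Suc.prems by (auto simp: quiet_history_def x)
    then show ?case
      unfolding x prod.case Let_def by (intro conjI pmf_map_eq_0)
  qed
qed

lemma prob_execution_quiet:
  assumes "S \<subseteq> {1..n}"
  shows "measure_pmf.prob (execution P n S t) {x. quiet_history S (snd x)}
    = measure_pmf.prob (silent_execution P S t) {x. quiet_history S (snd x)}"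
proof -
  let ?Q = "{x. quiet_history S (snd x)}"
  have emeas: "emeasure (measure_pmf M) ?Q
      = (\<integral>\<^sup>+ x. ennreal (pmf M x) * indicator ?Q x \<partial>count_space UNIV)" for M
    by (subst nn_integral_indicator[symmetric]) (auto simp: nn_integral_measure_pmf)
  have "emeasure (execution P n S t) ?Q = emeasure (silent_execution P S t) ?Q"
    unfolding emeas using pmf_execution_quiet[OF assms]
    by (intro nn_integral_cong) (auto simp: indicator_def)
  then show ?thesis
    by (simp add: measure_pmf.emeasure_eq_measure)
qed

section \<open>Independent runs of the single nodes\<close>

primrec isolated_run :: "('s, 'm) program \<Rightarrow> nat \<Rightarrow> ('s \<times> 'm action list) pmf" where
  "isolated_run P 0 = return_pmf (start P, [])"
| "isolated_run P (Suc t) =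
     bind_pmf (isolated_run P t) (\<lambda>x.
       map_pmf (\<lambda>d. (update P (snd d) None, snd x @ [fst d])) (draw P (fst x)))"

lemma isolated_run_actions:
  assumes "x \<in> set_pmf (isolated_run P t)"
  shows "length (snd x) = t \<and> (\<forall>a\<in>set (snd x). \<exists>s s'. (a, s') \<in> set_pmf (draw P s))"
  using assms by (induction t arbitrary: x) fastforce+

definition isolated_runs ::
  "(nat \<Rightarrow> ('s, 'm) program) \<Rightarrow> nat set \<Rightarrow> nat \<Rightarrow> (nat \<Rightarrow> 's \<times> 'm action list) pmf" where
  "isolated_runs P S t = Pi_pmf S (undefined, []) (\<lambda>u. isolated_run (P u) t)"

definition action_profile ::
  "nat set \<Rightarrow> (nat \<Rightarrow> 's \<times> 'm action list) \<Rightarrow> nat \<Rightarrow> nat \<Rightarrow> 'm action" where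
  "action_profile S x i = (\<lambda>u. if u \<in> S then snd (x u) ! i else (default_channel, Receive))"

definition joint_outcome where
  "joint_outcome P S t x =
    (\<lambda>u. if u \<in> S then fst (x u) else start (P u), map (action_profile S x) [0..<t])"

text \<open>Without receptions each node's transition depends on its own state only, so
  round-by-round product draws amount to a product of complete runs (\<open>Pi_pmf\<close> commutes
  with bind); \<open>joint_outcome\<close> transposes node histories into round profiles.\<close>

lemma silent_execution_eq_isolated_runs:
  fixes P :: "nat \<Rightarrow> ('s, 'm) program"
  assumes fin: "finite S"
  shows "silent_execution P S t = map_pmf (joint_outcome P S t) (isolated_runs P S t)"
proof (induction t)
  case 0
  show ?case
    using fin by (auto simp: fun_eq_iff isolated_runs_def Pi_pmf_return_pmf joint_outcome_def)
next
  case (Suc t)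
  let ?d = "((default_channel, Receive), undefined)"
  define ext where "ext = (\<lambda>(x :: nat \<Rightarrow> 's \<times> 'm action list) d u. if u \<in> S
    then (update (P u) (snd (d u)) None, snd (x u) @ [fst (d u)]) else (undefined, []))"
  have runs: "isolated_runs P S (Suc t) = bind_pmf (isolated_runs P S t)
    (\<lambda>x. map_pmf (ext x) (Pi_pmf S ?d (\<lambda>u. draw (P u) (fst (x u)))))"
    unfolding isolated_runs_def isolated_run.simps ext_def
    by (subst Pi_pmf_bind[OF fin, where d' = "(undefined, [])"],
        intro bind_pmf_cong refl, unfold map_pmf_def,
        subst Pi_pmf_bind[OF fin, where d' = ?d]) (simp add: Pi_pmf_return_pmf fin)
  show ?case
    unfolding silent_execution.simps Suc.IH runs bind_map_pmf map_bind_pmf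
  proof (rule bind_pmf_cong[OF refl])
    fix x assume x: "x \<in> set_pmf (isolated_runs P S t)"
    have len: "length (snd (x u)) = t" if "u \<in> S" for u
      using x that isolated_run_actions[of "x u" "P u" t]
      by (auto simp: isolated_runs_def set_Pi_pmf[OF fin] PiE_dflt_def)
    have D: "Pi_pmf S ?d (\<lambda>u. draw (P u) (fst (joint_outcome P S t x) u))
        = Pi_pmf S ?d (\<lambda>u. draw (P u) (fst (x u)))"
      by (intro Pi_pmf_cong) (auto simp: joint_outcome_def)
    show "(case joint_outcome P S t x of (\<sigma>, h) \<Rightarrow>
        map_pmf
         (\<lambda>d. (\<lambda>u. if u \<in> S then update (P u) (snd (d u)) None else \<sigma> u, h @ [\<lambda>u. fst (d u)]))
         (Pi_pmf S ?d (\<lambda>u. draw (P u) (\<sigma> u))))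
      = map_pmf (joint_outcome P S (Suc t)) (map_pmf (ext x) (Pi_pmf S ?d (\<lambda>u. draw (P u) (fst (x u)))))"
      unfolding case_prod_beta D pmf.map_comp
    proof (rule map_pmf_cong[OF refl])
      fix d assume "d \<in> set_pmf (Pi_pmf S ?d (\<lambda>u. draw (P u) (fst (x u))))"
      then have d: "d u = ?d" if "u \<notin> S" for u
        using set_Pi_pmf_subset[OF fin] that by fastforce
      have "action_profile S (ext x d) i = action_profile S x i" if "i < t" for i
        using that len by (auto simp: action_profile_def ext_def nth_append)
      moreover have "action_profile S (ext x d) t = (\<lambda>u. fst (d u))"
        using len d by (auto simp: action_profile_def ext_def nth_append)
      ultimately show "(\<lambda>u. if u \<in> S then update (P u) (snd (d u)) None
            else fst (joint_outcome P S t x) u,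
          snd (joint_outcome P S t x) @ [\<lambda>u. fst (d u)])
        = (joint_outcome P S (Suc t) \<circ> ext x) d"
        by (auto simp: joint_outcome_def ext_def)
    qed
  qed
qed

text \<open>Couples all activated sets: the coin tosses of \<open>V\<close> serve every
  \<open>S\<close> by restriction, so they can be fixed before \<open>S\<close> is chosen.\<close>

lemma isolated_runs_subset:
  assumes "finite V" "S \<subseteq> V"
  shows "isolated_runs P S t
    = map_pmf (\<lambda>x u. if u \<in> S then x u else (undefined, [])) (isolated_runs P V t)"
  unfolding isolated_runs_def using assms by (rule Pi_pmf_subset)

lemma prob_quiet_isolated_runs_le:
  assumes "S \<subseteq> {1..n}"
  shows "measure_pmf.prob (isolated_runs P {1..n} t) {x. \<forall>i<t. quiet_round S (action_profile S x i)}
    \<le> 1 - wakeup_solved_prob P n S t"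
proof -
  have fin: "finite S" using assms finite_subset by blast
  have restrict: "action_profile S (\<lambda>u. if u \<in> S then x u else (undefined, [])) = action_profile S x"
    for x :: "nat \<Rightarrow> 'a \<times> 'b action list"
    by (auto simp: action_profile_def fun_eq_iff)
  have not_solved: "\<not> solves_in_round S a" if "quiet_round S a" for a :: "nat \<Rightarrow> 'b action"
    using that unfolding quiet_round_def solves_in_round_def by blast
  have ball: "(\<forall>i<t. Q i) \<longleftrightarrow> (\<forall>i\<in>{0..<t}. Q i)" for Q
    by auto
  have "measure_pmf.prob (isolated_runs P {1..n} t) {x. \<forall>i<t. quiet_round S (action_profile S x i)}
      = measure_pmf.prob (silent_execution P S t) {y. quiet_history S (snd y)}"
    using assms
    by (simp add: silent_execution_eq_isolated_runs[OF fin] isolated_runs_subset[OF _ assms]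
        vimage_def joint_outcome_def quiet_history_def restrict ball)
  also have "\<dots> = measure_pmf.prob (execution P n S t) {y. quiet_history S (snd y)}"
    by (rule prob_execution_quiet[OF assms, symmetric])
  also have "\<dots> \<le> measure_pmf.prob (execution P n S t)
      (- {(\<sigma>, h). \<exists>a\<in>set h. solves_in_round S a})"
    by (intro measure_pmf.finite_measure_mono) (use not_solved in \<open>auto simp: quiet_history_def\<close>)
  also have "\<dots> = 1 - wakeup_solved_prob P n S t"
    unfolding wakeup_solved_prob_def by (subst measure_pmf.prob_compl[symmetric]) (auto simp: Compl_eq_Diff_UNIV)
  finally show ?thesis .
qed

section \<open>The lower bound\<close>

text \<open>Independent of the activated set. The full set is included to meet the hypothesis
  \<open>V \<in> \<F>\<close> of \<open>random_subset_isolates_none\<close>.\<close>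

definition transmitter_sets ::
  "nat \<Rightarrow> nat \<Rightarrow> nat \<Rightarrow> (nat \<Rightarrow> 's \<times> 'm action list) \<Rightarrow> nat set set" where
  "transmitter_sets n C T x = insert {1..n}
    ((\<lambda>(i, c). {u \<in> {1..n}. transmits_on (action_profile {1..n} x i) u c}) ` ({..<T} \<times> {1..C}))"

lemma card_transmitter_sets: "card (transmitter_sets n C T x) \<le> C * T + 1"
proof -
  let ?F = "\<lambda>(i, c). {u \<in> {1..n}. transmits_on (action_profile {1..n} x i) u c}"
  have "card (transmitter_sets n C T x) \<le> Suc (card (?F ` ({..<T} \<times> {1..C})))"
    unfolding transmitter_sets_def by (rule card_insert_le_m1) auto
  also have "card (?F ` ({..<T} \<times> {1..C})) \<le> card ({..<T} \<times> {1..C})"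
    by (rule card_image_le) simp
  finally show ?thesis by (simp add: mult.commute)
qed

text \<open>A lone transmitter on \<open>c\<close> in round \<open>i\<close> would be the only
  common element of \<open>S\<close> and the corresponding transmitter set; that set is listed
  because only channels in \<open>{1..C}\<close> are ever drawn.\<close>

lemma quiet_round_if_isolates_none:
  assumes x: "x \<in> set_pmf (isolated_runs P {1..n} T)"
    and channels: "\<And>u s c y s'. u \<in> {1..n} \<Longrightarrow> ((c, y), s') \<in> set_pmf (draw (P u) s) \<Longrightarrow> c \<in> {1..C}"
    and S: "S \<subseteq> {1..n}" "isolates_none (transmitter_sets n C T x) S" and i: "i < T"
  shows "quiet_round S (action_profile S x i)"
  unfolding quiet_round_def
proof (intro allI notI)
  fix c assume "\<exists>!u. u \<in> S \<and> transmits_on (action_profile S x i) u c"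
  then obtain u where u: "u \<in> S" "transmits_on (action_profile S x i) u c"
    and uniq: "\<And>v. v \<in> S \<Longrightarrow> transmits_on (action_profile S x i) v c \<Longrightarrow> v = u"
    by blast
  have profile: "transmits_on (action_profile {1..n} x i) v c \<longleftrightarrow> transmits_on (action_profile S x i) v c"
    if "v \<in> S" for v
    using that S(1) by (auto simp: transmits_on_def action_profile_def)
  let ?F = "{u \<in> {1..n}. transmits_on (action_profile {1..n} x i) u c}"
  have "?F \<inter> S = {u}"
    using u uniq profile S(1) by blast
  then have single: "card (?F \<inter> S) = 1" by simp
  have "x u \<in> set_pmf (isolated_run (P u) T)"
    using x u(1) S(1) by (auto simp: isolated_runs_def set_Pi_pmf PiE_dflt_def)
  from isolated_run_actions[OF this] i
  have "\<exists>s s'. (snd (x u) ! i, s') \<in> set_pmf (draw (P u) s)" by simp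
  then have "c \<in> {1..C}"
    using u S(1) channels[of u c] by (auto simp: transmits_on_def action_profile_def)
  then have "?F \<in> transmitter_sets n C T x"
    unfolding transmitter_sets_def using i by force
  then show False
    using S(2) single unfolding isolates_none_def by blast
qed

text \<open>Double counting: for each outcome \<open>x\<close> some scale has large probability, but
  which one depends on \<open>x\<close>, so \<open>G\<close> sums over all \<open>K\<close> scales.
  After exchanging the averages each \<open>S\<close> fails with probability at most \<epsilon>, and
  the weights of each scale sum to 1.\<close>

lemma wakeup_failure_bound:
  fixes P :: "nat \<Rightarrow> ('s, 'm) program"
  assumes channels: "\<And>u s c y s'. u \<in> {1..n} \<Longrightarrow> ((c, y), s') \<in> set_pmf (draw (P u) s) \<Longrightarrow> c \<in> {1..C}"
    and solves: "\<And>S. S \<subseteq> {1..n} \<Longrightarrow> S \<noteq> {} \<Longrightarrow> 1 - \<epsilon> \<le> wakeup_solved_prob P n S T"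
    and "0 \<le> \<epsilon>" and K: "1 \<le> K" and N: "N = C * T + 1"
    and large: "2 ^ K * (8 * real N) < real K * real n"
  shows "exp (- (16 * real N / real K)) \<le> real K * \<epsilon>"
proof -
  let ?V = "{1..n}"
  define J where "J = isolated_runs P ?V T"
  define B where "B = (\<lambda>S. {x :: nat \<Rightarrow> 's \<times> 'm action list. S \<noteq> {} \<and> isolates_none (transmitter_sets n C T x) S})"
  define w :: "nat \<Rightarrow> nat set \<Rightarrow> real" where
    "w = (\<lambda>k S. (1 / 2 ^ k) ^ card S * (1 - 1 / 2 ^ k) ^ card (?V - S))"
  define G where "G = (\<lambda>x. \<Sum>k=1..K. \<Sum>S\<in>Pow ?V. w k S * indicator (B S) x)"
  have w: "0 \<le> w k S" for k S
    by (simp add: w_def)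
  have "exp (- (16 * real N / real K)) \<le> G x" for x
  proof -
    have "\<exists>k\<in>{1..K}. exp (- (16 * real N / real K)) \<le> random_subset_avg (1 / 2 ^ k) ?V
        (\<lambda>S. of_bool (S \<noteq> {} \<and> isolates_none (transmitter_sets n C T x) S))"
      using card_transmitter_sets[of n C T x] K N large
      by (intro random_subset_isolates_none) (auto simp: transmitter_sets_def)
    then obtain k where k: "k \<in> {1..K}"
      and le: "exp (- (16 * real N / real K)) \<le> (\<Sum>S\<in>Pow ?V. w k S * indicator (B S) x)"
      by (auto simp: random_subset_avg_def w_def B_def indicator_def of_bool_def)
    have "(\<Sum>S\<in>Pow ?V. w k S * indicator (B S) x) \<le> G x"
      unfolding G_def using k w
      by (intro member_le_sum[of k _ "\<lambda>k. \<Sum>S\<in>Pow ?V. w k S * indicator (B S) x"])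
        (auto intro!: sum_nonneg)
    with le show ?thesis by linarith
  qed
  moreover have int: "integrable J (\<lambda>x. w k S * indicator (B S) x)" for k S
    by (intro integrable_mult_right)
      (simp add: integrable_real_indicator measure_pmf.emeasure_eq_measure)
  ultimately have "exp (- (16 * real N / real K)) \<le> measure_pmf.expectation J G"
    unfolding G_def
    by (intro measure_pmf.integral_ge_const Bochner_Integration.integrable_sum AE_I2) auto
  also have "\<dots> = (\<Sum>k=1..K. \<Sum>S\<in>Pow ?V. measure_pmf.expectation J (\<lambda>x. w k S * indicator (B S) x))"
    unfolding G_def by (simp only: Bochner_Integration.integral_sum Bochner_Integration.integrable_sum int)
  also have "\<dots> = (\<Sum>k=1..K. \<Sum>S\<in>Pow ?V. w k S * measure_pmf.prob J (B S))"
    by simp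
  also have "\<dots> \<le> (\<Sum>k=1..K. \<Sum>S\<in>Pow ?V. w k S * \<epsilon>)"
  proof (intro sum_mono mult_left_mono w)
    fix S assume S: "S \<in> Pow ?V"
    show "measure_pmf.prob J (B S) \<le> \<epsilon>"
    proof (cases "S = {}")
      case True
      then show ?thesis using \<open>0 \<le> \<epsilon>\<close> by (simp add: B_def)
    next
      case False
      have "quiet_round S (action_profile S x i)" if "x \<in> set_pmf J" "x \<in> B S" "i < T" for x i
        using that S by (intro quiet_round_if_isolates_none[OF _ channels]) (auto simp: J_def B_def)
      then have "measure_pmf.prob J (B S)
          \<le> measure_pmf.prob J {x. \<forall>i<T. quiet_round S (action_profile S x i)}"
        by (intro measure_pmf.finite_measure_mono_AE) (auto simp: AE_measure_pmf_iff)
      also have "\<dots> \<le> \<epsilon>"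
        using prob_quiet_isolated_runs_le[of S n P T] solves[of S] S False unfolding J_def by simp
      finally show ?thesis .
    qed
  qed
  also have "\<dots> = (\<Sum>k=1..K. random_subset_avg (1 / 2 ^ k) ?V (\<lambda>_. \<epsilon>))"
    by (simp only: random_subset_avg_def w_def)
  finally show ?thesis by simp
qed

lemma wakeup_rounds_bound:
  assumes "uses_available_channels A" "solves_wakeup_whp A f" "1 \<le> C" "1 \<le> n"
    and K: "1 \<le> K" and N: "N = C * f n C + 1"
    and large: "2 ^ K * (8 * real N) < real K * real n"
  shows "real n \<le> real K * exp (16 * real N / real K)"
proof -
  have "exp (- (16 * real N / real K)) \<le> real K * (1 / real n)"
  proof (rule wakeup_failure_bound[where P = "A n C" and C = C and T = "f n C"])
    show "c \<in> {1..C}" if "u \<in> {1..n}" "((c, y), s') \<in> set_pmf (draw (A n C u) s)" for u s c y s'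
      using assms(1,3) that unfolding uses_available_channels_def by blast
    show "1 - 1 / real n \<le> wakeup_solved_prob (A n C) n S (f n C)" if "S \<subseteq> {1..n}" "S \<noteq> {}" for S
      using assms(2-4) that unfolding solves_wakeup_whp_def by blast
  qed (use K N large in auto)
  then show ?thesis
    using assms(4) by (simp add: exp_minus field_simps)
qed

theorem theorem7p3:
  fixes A :: "('s, 'm) algorithm" and f :: "nat \<Rightarrow> nat \<Rightarrow> nat"
  assumes "uses_available_channels A"
    and "solves_wakeup_whp A f"
  shows "\<forall>C\<ge>1. (\<lambda>n. real (f n C)) \<in> \<Omega>(\<lambda>n. (log 2 (real n))\<^sup>2 / real C + log 2 (real n))"
proof (intro allI impI)
  fix C :: nat assume C: "1 \<le> C"
  have "\<forall>\<^sub>F n::nat in sequentially. log 2 (real n) \<ge> 32"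
    by real_asymp
  moreover have "\<forall>\<^sub>F n::nat in sequentially.
      log 2 (real n) / 2 * 2 powr (log 2 (real n) / 2) < real n"
    by real_asymp
  moreover have "\<forall>\<^sub>F n::nat in sequentially.
      2 powr (log 2 (real n) / 2) * (log 2 (real n))\<^sup>2 / 32 < log 2 (real n) / 4 * real n"
    by real_asymp
  \<comment> \<open>The factor \<open>1024 * real C\<close> may depend on \<open>C\<close>, which is
    fixed before \<open>n\<close> grows.\<close>
  ultimately have "\<forall>\<^sub>F n in sequentially.
      norm ((log 2 (real n))\<^sup>2 / real C + log 2 (real n)) \<le> 1024 * real C * norm (real (f n C))"
  proof eventually_elim
    case (elim n)
    define L where "L = log 2 (real n)"
    \<comment> \<open>\<open>2 ^ K\<close> is at most the square root of \<open>n\<close>, which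
      leaves room for \<open>large\<close>, while \<open>K\<close> is still of order
      \<open>log n\<close>.\<close>
    define K where "K = nat \<lfloor>L / 2\<rfloor>"
    define N where "N = C * f n C + 1"
    note elim = elim[folded L_def]
    have n: "1 \<le> n" using elim(1) by (cases n) (auto simp: L_def log_def)
    have K: "L / 4 \<le> real K" "real K \<le> L / 2" "1 \<le> K"
      using elim(1) unfolding K_def by linarith+
    \<comment> \<open>Otherwise \<open>16 N / K \<le> L / 4\<close>, and as
      \<open>exp 1 \<le> 4\<close> the bound on \<open>n\<close> becomes
      \<open>n \<le> L / 2 * 2 powr (L / 2)\<close>, which fails for large \<open>n\<close>.\<close>
    have "L\<^sup>2 / 256 \<le> real N"
    proof (rule ccontr)
      assume "\<not> L\<^sup>2 / 256 \<le> real N"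
      then have N: "real N < L\<^sup>2 / 256" by simp
      have "2 ^ K * (8 * real N) \<le> 2 powr (L / 2) * (8 * (L\<^sup>2 / 256))"
        using N K(2) by (intro mult_mono) (auto simp: powr_realpow[symmetric])
      also have "\<dots> < L / 4 * real n" using elim(3) by simp
      also have "\<dots> \<le> real K * real n" using K by (intro mult_right_mono) auto
      finally have "real n \<le> real K * exp (16 * real N / real K)"
        using wakeup_rounds_bound[OF assms C n K(3) N_def] by simp
      also have "16 * real N / real K \<le> 16 * (L\<^sup>2 / 256) / (L / 4)"
        using N K elim(1) by (intro frac_le) auto
      also have "\<dots> = L / 4"
        using elim(1) by (simp add: power2_eq_square)
      also have "real K * exp (L / 4) \<le> L / 2 * exp (L / 4)"
        using K by (intro mult_right_mono) auto
      also have "exp (L / 4) \<le> 2 powr (L / 2)"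
      proof -
        have "exp (L / 4) = exp 1 powr (L / 4)" by (simp add: powr_def)
        also have "\<dots> \<le> (2 powr 2) powr (L / 4)"
          using exp_le elim(1) by (intro powr_mono2) auto
        finally show ?thesis by (simp only: powr_powr) simp
      qed
      also have "L / 2 * 2 powr (L / 2) < real n" by (rule elim(2))
      finally show False using K by (simp add: mult_left_mono)
    qed
    then have "L\<^sup>2 / 256 \<le> real C * real (f n C) + 1" by (simp add: N_def)
    \<comment> \<open>Since \<open>L * L \<ge> 1024\<close>, the summand 1 in \<open>N\<close> uses
      up at most a quarter of \<open>L\<^sup>2 / 256\<close>.\<close>
    moreover have "32 * 32 \<le> L * L" using elim(1) by (intro mult_mono) auto
    ultimately have "2 * L\<^sup>2 \<le> 1024 * real C * real (f n C)"
      by (simp add: power2_eq_square)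
    moreover have "L\<^sup>2 / real C \<le> L\<^sup>2"
      using C by (simp add: divide_le_eq mult_le_cancel_left1)
    moreover have "1 * L \<le> L * L" using elim(1) by (intro mult_right_mono) auto
    ultimately have "L\<^sup>2 / real C + L \<le> 1024 * real C * real (f n C)"
      by (simp add: power2_eq_square)
    moreover have "0 \<le> L\<^sup>2 / real C + L" using elim(1) by simp
    ultimately show ?case by (simp add: L_def)
  qed
  then have "(\<lambda>n. (log 2 (real n))\<^sup>2 / real C + log 2 (real n)) \<in> O(\<lambda>n. real (f n C))"
    by (rule bigoI)
  then show "(\<lambda>n. real (f n C)) \<in> \<Omega>(\<lambda>n. (log 2 (real n))\<^sup>2 / real C + log 2 (real n))"
    by (simp add: bigomega_iff_bigo)
qed

end
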